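(* Let $k\ge 2$ be an integer. The vertex operator algebra $N_0$ is generated by $\omega$ and $W^3$. Consequently $N_0$ equals the subalgebra generated by $\omega, W^3, W^4, W^5$ for any $W^4,W^5\in N_0$ (in particular it coincides with the $W$-algebra $W(2,3,4,5)$ realized inside $N_0$).
   Context: Let $\{h,e,f\}$ be the standard basis of $sl_2$ ($[h,e]=2e$, $[h,f]=-2f$, $[e,f]=h$), with normalized form $\langle h,h\rangle=2$, $\langle e,f\rangle=1$, other pairings zero. $a(n)$ denotes the action of $a\otimes t^n\in\widehat{sl}_2$, with $[a(m),b(n)]=[a,b](m+n)+m\langle a,b\rangle\delta_{m+n,0}k$. $V(k,0)$ is the level $k$ induced (Weyl) module of $\widehat{sl}_2$ generated by $\mathbb{1}$ with $a(n)\mathbb{1}=0$ for $n\ge0$; it is a vertex operator algebra with $Y(a(-1)\mathbb{1},z)=\sum_n a(n)z^{-n-1}$. Define $N_0=\{v\in V(k,0)\mid h(m)v=0 \text{ for all } m\ge 0\}$; this is the commutant in $V(k,0)$ of the Heisenberg vertex subalgebra spanned by the vectors $h(-i_1)\cdots h(-i_p)\mathbb{1}$, and it is a vertex operator algebra with Virasoro vector $\omega=\frac{1}{2k(k+2)}\big(-kh(-2)\mathbb{1}-h(-1)^2\mathbb{1}+2k\,e(-1)f(-1)\mathbb{1}\big)$ of central charge $2(k-1)/(k+2)$. Define $W^3=k^2h(-3)\mathbb{1}+3kh(-2)h(-1)\mathbb{1}+2h(-1)^3\mathbb{1}-6k\,h(-1)e(-1)f(-1)\mathbb{1}+3k^2e(-2)f(-1)\mathbb{1}-3k^2e(-1)f(-2)\mathbb{1}\in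 N_0$ (a Virasoro primary vector of weight $3$). "Generated" means the smallest vertex subalgebra containing the given vectors. *)

theory Defs
  imports Complex_Main
begin

text \<open>A vertex algebra structure on the complex vector space 'v (scalar multiplication sc)
  is given by the n-th products Y n u v = u_n v (n an integer) and the vacuum vac.\<close>

definition sgn_pow :: "int \<Rightarrow> complex" where
  "sgn_pow l = (if even l then 1 else -1)"

definition vertex_algebra ::
  "(complex \<Rightarrow> 'v::ab_group_add \<Rightarrow> 'v) \<Rightarrow> (int \<Rightarrow> 'v \<Rightarrow> 'v \<Rightarrow> 'v) \<Rightarrow> 'v \<Rightarrow> bool" where
  "vertex_algebra sc Y vac \<longleftrightarrow>
     vector_space sc \<and>
     (\<forall>n u. Vector_Spaces.linear sc sc (Y n u)) \<and>
     (\<forall>n v. Vector_Spaces.linear sc sc (\<lambda>u. Y n u v)) \<and>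
     (\<forall>u v. \<exists>N. \<forall>n\<ge>N. Y n u v = 0) \<and>
     (\<forall>n v. Y n vac v = (if n = -1 then v else 0)) \<and>
     (\<forall>u n. n \<ge> 0 \<longrightarrow> Y n u vac = 0) \<and>
     (\<forall>u. Y (-1) u vac = u) \<and>
     (\<forall>u v w m n l. \<exists>N0. \<forall>N\<ge>N0.
        (\<Sum>i\<le>N. sc (of_int m gchoose i) (Y (m + n - int i) (Y (l + int i) u v) w)) =
        (\<Sum>i\<le>N. sc ((-1) ^ i * (of_int l gchoose i))
             (Y (l + m - int i) u (Y (n + int i) v w)
              - sc (sgn_pow l) (Y (l + n - int i) v (Y (m + int i) u w)))))"

definition vgen ::
  "(complex \<Rightarrow> 'v::ab_group_add \<Rightarrow> 'v) \<Rightarrow> (int \<Rightarrow> 'v \<Rightarrow> 'v \<Rightarrow> 'v) \<Rightarrow> 'v \<Rightarrow> 'v set \<Rightarrow> 'v set" where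
  "vgen sc Y vac S = \<Inter>{U. module.subspace sc U \<and> vac \<in> U \<and> S \<subseteq> U \<and>
                           (\<forall>u\<in>U. \<forall>v\<in>U. \<forall>n. Y n u v \<in> U)}"

text \<open>Basis of sl_2 encoded as naturals: 0 = h, 1 = e, 2 = f.
  sl2_br a b c is the coefficient of basis vector c in [a,b]; sl2_form is the normalized form.\<close>

definition sl2_br :: "nat \<Rightarrow> nat \<Rightarrow> nat \<Rightarrow> complex" where
  "sl2_br a b c =
     (if (a, b, c) = (0, 1, 1) then 2 else
      if (a, b, c) = (1, 0, 1) then -2 else
      if (a, b, c) = (0, 2, 2) then -2 else
      if (a, b, c) = (2, 0, 2) then 2 else
      if (a, b, c) = (1, 2, 0) then 1 else
      if (a, b, c) = (2, 1, 0) then -1 else 0)"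

definition sl2_form :: "nat \<Rightarrow> nat \<Rightarrow> complex" where
  "sl2_form a b = (if (a, b) = (0, 0) then 2 else
                   if (a, b) = (1, 2) \<or> (a, b) = (2, 1) then 1 else 0)"

definition pbw_le :: "nat \<times> int \<Rightarrow> nat \<times> int \<Rightarrow> bool" where
  "pbw_le p q \<longleftrightarrow> snd p < snd q \<or> (snd p = snd q \<and> fst p \<le> fst q)"

definition pbw_words :: "(nat \<times> int) list set" where
  "pbw_words = {ms. (\<forall>p\<in>set ms. fst p < 3 \<and> snd p < 0) \<and> sorted_wrt pbw_le ms}"

definition mono :: "(int \<Rightarrow> 'v \<Rightarrow> 'v \<Rightarrow> 'v) \<Rightarrow> 'v \<Rightarrow> (nat \<Rightarrow> 'v) \<Rightarrow> (nat \<times> int) list \<Rightarrow> 'v" where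
  "mono Y vac x ms = foldr (\<lambda>p v. Y (snd p) (x (fst p)) v) ms vac"

text \<open>(sc, Y, vac) is (an isomorphic copy of) the affine vertex algebra V(k,0), with
  x a = a(-1)vac, i.e. a(n) acts as Y n (x a): the modes satisfy the level k affine sl_2
  relations and the ordered PBW monomials in the negative modes form a basis (which is exactly
  the induced module U(hat sl_2) \<otimes> C_k).\<close>

definition is_Vk0 ::
  "(complex \<Rightarrow> 'v::ab_group_add \<Rightarrow> 'v) \<Rightarrow> (int \<Rightarrow> 'v \<Rightarrow> 'v \<Rightarrow> 'v) \<Rightarrow> 'v \<Rightarrow> (nat \<Rightarrow> 'v) \<Rightarrow> int \<Rightarrow> bool" where
  "is_Vk0 sc Y vac x k \<longleftrightarrow>
     vertex_algebra sc Y vac \<and>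
     (\<forall>a<3. \<forall>b<3. \<forall>m n v.
        Y m (x a) (Y n (x b) v) - Y n (x b) (Y m (x a) v) =
        (\<Sum>c<3. sc (sl2_br a b c) (Y (m + n) (x c) v)) +
        (if m + n = 0 then sc (of_int m * sl2_form a b * of_int k) v else 0)) \<and>
     inj_on (mono Y vac x) pbw_words \<and>
     \<not> module.dependent sc (mono Y vac x ` pbw_words) \<and>
     module.span sc (mono Y vac x ` pbw_words) = UNIV"

definition N0 :: "(int \<Rightarrow> 'v \<Rightarrow> 'v \<Rightarrow> 'v) \<Rightarrow> (nat \<Rightarrow> 'v::zero) \<Rightarrow> 'v set" where
  "N0 Y x = {v. \<forall>m\<ge>0. Y m (x 0) v = 0}"

definition omega ::
  "(complex \<Rightarrow> 'v::ab_group_add \<Rightarrow> 'v) \<Rightarrow> (int \<Rightarrow> 'v \<Rightarrow> 'v \<Rightarrow> 'v) \<Rightarrow> 'v \<Rightarrow> (nat \<Rightarrow> 'v) \<Rightarrow> int \<Rightarrow> 'v" where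
  "omega sc Y vac x k =
     sc (1 / (2 * of_int k * (of_int k + 2)))
       (sc (- of_int k) (Y (-2) (x 0) vac)
        - Y (-1) (x 0) (Y (-1) (x 0) vac)
        + sc (2 * of_int k) (Y (-1) (x 1) (Y (-1) (x 2) vac)))"

definition W3 ::
  "(complex \<Rightarrow> 'v::ab_group_add \<Rightarrow> 'v) \<Rightarrow> (int \<Rightarrow> 'v \<Rightarrow> 'v \<Rightarrow> 'v) \<Rightarrow> 'v \<Rightarrow> (nat \<Rightarrow> 'v) \<Rightarrow> int \<Rightarrow> 'v" where
  "W3 sc Y vac x k =
       sc (of_int k ^ 2) (Y (-3) (x 0) vac)
     + sc (3 * of_int k) (Y (-2) (x 0) (Y (-1) (x 0) vac))
     + sc 2 (Y (-1) (x 0) (Y (-1) (x 0) (Y (-1) (x 0) vac)))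
     - sc (6 * of_int k) (Y (-1) (x 0) (Y (-1) (x 1) (Y (-1) (x 2) vac)))
     + sc (3 * of_int k ^ 2) (Y (-2) (x 1) (Y (-1) (x 2) vac))
     - sc (3 * of_int k ^ 2) (Y (-1) (x 1) (Y (-2) (x 2) vac))"

end

theory Submission
  imports Defs
begin

text \<open>Let \<open>G\<close> be generated by \<open>h = h(-1) vac\<close>, \<open>\<omega>\<close> and \<open>W\<^sup>3\<close>, and \<open>U\<close> by \<open>\<omega>\<close> and \<open>W\<^sup>3\<close>
  alone. From \<open>\<omega>\<close> and \<open>W\<^sup>3\<close> one reads off \<open>e(-1)f(-1) vac\<close> and \<open>e(-2)f(-1) vac\<close> in \<open>G\<close>, and a
  Borcherds identity then yields all \<open>e(-m)f(-1) vac\<close>, the leading coefficient being positive.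
  Hence \<open>G\<close> is stable under all \<open>e(m)f(n)\<close> and so contains every PBW monomial of charge zero,
  that is, the kernel of \<open>h(0)\<close>, which contains \<open>N0\<close>. On the other hand \<open>G\<close> is spanned by the
  vectors \<open>h(-i\<^sub>1)\<dots>h(-i\<^sub>p) u\<close> with \<open>u \<in> U\<close>. The mode \<open>(h(-1)h)(1)\<close> multiplies such a vector by
  \<open>4k(i\<^sub>1 + \<dots> + i\<^sub>p)\<close> and kills \<open>N0\<close>, so that only the terms with \<open>p = 0\<close> contribute to an
  element of \<open>N0\<close>.\<close>

section \<open>Vertex algebras and generated subalgebras\<close>

locale vertex_alg =
  fixes sc :: "complex \<Rightarrow> 'v::ab_group_add \<Rightarrow> 'v"
    and Y :: "int \<Rightarrow> 'v \<Rightarrow> 'v \<Rightarrow> 'v" and vac :: 'v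
  assumes va: "vertex_algebra sc Y vac"
begin

sublocale vector_space sc
  using va by (simp add: vertex_algebra_def)

lemma linear_Y_right: "Vector_Spaces.linear sc sc (Y n u)"
  and linear_Y_left: "Vector_Spaces.linear sc sc (\<lambda>u. Y n u v)"
  using va by (simp_all add: vertex_algebra_def)

lemma linear_facts:
  assumes "Vector_Spaces.linear sc sc T"
  shows "T 0 = 0" "T (u + v) = T u + T v" "T (u - v) = T u - T v" "T (- u) = - T u"
    "T (sc c u) = sc c (T u)" "T (sum g I) = (\<Sum>i\<in>I. T (g i))"
proof -
  interpret T: Vector_Spaces.linear sc sc T by (fact assms)
  show "T 0 = 0" "T (u + v) = T u + T v" "T (u - v) = T u - T v" "T (- u) = - T u"
    "T (sc c u) = sc c (T u)" "T (sum g I) = (\<Sum>i\<in>I. T (g i))"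
    by (simp_all add: T.add T.diff T.neg T.scale T.sum)
qed

lemmas Y_right = linear_facts[OF linear_Y_right]
lemmas Y_left = linear_facts[OF linear_Y_left]
lemmas Y_linear = Y_right Y_left

lemma Y_truncation: "\<exists>N. \<forall>n\<ge>N. Y n u v = 0"
  and Y_vac_left: "Y n vac v = (if n = -1 then v else 0)"
  and Y_vac_right: "n \<ge> 0 \<Longrightarrow> Y n u vac = 0"
  and Y_creation: "Y (-1) u vac = u"
  using va by (simp_all add: vertex_algebra_def)

lemma borcherds: "\<exists>N0. \<forall>N\<ge>N0.
    (\<Sum>i\<le>N. sc (of_int m gchoose i) (Y (m + n - int i) (Y (l + int i) u v) w)) =
    (\<Sum>i\<le>N. sc ((-1) ^ i * (of_int l gchoose i))
         (Y (l + m - int i) u (Y (n + int i) v w)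
          - sc (sgn_pow l) (Y (l + n - int i) v (Y (m + int i) u w))))"
  using va unfolding vertex_algebra_def by blast

section \<open>Consequences of the Borcherds identity\<close>

lemma sum_gchoose_zero:
  "(\<Sum>i\<le>N. sc (c i * (0 gchoose i)) (g i)) = sc (c 0) (g 0)"
proof -
  have "(\<Sum>i\<le>N. sc (c i * (0 gchoose i)) (g i)) = (\<Sum>i\<le>N. if i = 0 then sc (c i) (g i) else 0)"
    by (intro sum.cong refl) (auto simp: gbinomial_0_left)
  then show ?thesis by simp
qed

lemma commutator: "\<exists>N0. \<forall>N\<ge>N0. Y m u (Y n v w) - Y n v (Y m u w) =
    (\<Sum>i\<le>N. sc (of_int m gchoose i) (Y (m + n - int i) (Y (int i) u v) w))"
proof -
  from borcherds[of m n 0 u v w] obtain N0 where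
    "\<And>N. N \<ge> N0 \<Longrightarrow> (\<Sum>i\<le>N. sc (of_int m gchoose i) (Y (m + n - int i) (Y (int i) u v) w)) =
      Y m u (Y n v w) - Y n v (Y m u w)"
    by (auto simp: sum_gchoose_zero sgn_pow_def)
  then show ?thesis by (intro exI[of _ N0]) simp
qed

lemma iterate: "\<exists>N0. \<forall>N\<ge>N0. Y n (Y l u v) w =
    (\<Sum>i\<le>N. sc ((-1) ^ i * (of_int l gchoose i))
         (Y (l - int i) u (Y (n + int i) v w) - sc (sgn_pow l) (Y (l + n - int i) v (Y (int i) u w))))"
  using borcherds[of 0 n l u v w] sum_gchoose_zero[of "\<lambda>_. 1"] by simp

text \<open>\<open>Y (-2) u vac\<close> is the translation operator applied to \<open>u\<close>. In
  the iterate formula \<open>u(i) vac\<close> vanishes for \<open>i \<ge> 0\<close> and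
  \<open>v(i - 2) vac\<close> for \<open>i \<ge> 2\<close>, so only two terms remain.\<close>

lemma translation_product:
  "Y (-2) (Y l u v) vac = Y l u (Y (-2) v vac) - sc (of_int l) (Y (l - 1) u v)"
proof -
  define g where "g i = sc ((-1) ^ i * (of_int l gchoose i))
         (Y (l - int i) u (Y (-2 + int i) v vac) - sc (sgn_pow l) (Y (l + -2 - int i) v (Y (int i) u vac)))" for i
  from iterate[of "-2" l u v vac] obtain N0 where N0: "\<And>N. N \<ge> N0 \<Longrightarrow> Y (-2) (Y l u v) vac = (\<Sum>i\<le>N. g i)"
    unfolding g_def by blast
  have "Y (-2) (Y l u v) vac = (\<Sum>i\<le>max N0 1. g i)"
    by (rule N0) simp
  also have "\<dots> = (\<Sum>i\<in>{0, 1}. g i)"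
    by (rule sum.mono_neutral_right) (auto simp: g_def Y_vac_right Y_linear)
  finally show ?thesis
    by (simp add: g_def Y_vac_right Y_creation Y_linear)
qed

text \<open>The commutator of two modes involves only the products \<open>u(i) v\<close> with
  \<open>i \<ge> 0\<close>.\<close>

lemma Y_commute:
  assumes "\<And>i. i \<ge> 0 \<Longrightarrow> Y i u v = 0"
  shows "Y m u (Y n v w) = Y n v (Y m u w)"
  using commutator[of m u n v w] assms by (auto simp: Y_linear)

section \<open>Subalgebras and generation\<close>

definition subalgebra :: "'v set \<Rightarrow> bool" where
  "subalgebra U \<longleftrightarrow> subspace U \<and> vac \<in> U \<and> (\<forall>u\<in>U. \<forall>v\<in>U. \<forall>n. Y n u v \<in> U)"

lemma vgen_alt: "vgen sc Y vac S = \<Inter>{U. subalgebra U \<and> S \<subseteq> U}"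
  unfolding vgen_def subalgebra_def by (rule arg_cong[where f = Inter]) auto

lemma subalgebra_vgen: "subalgebra (vgen sc Y vac S)"
  unfolding vgen_alt subalgebra_def subspace_def by auto

lemma vgen_least: "subalgebra U \<Longrightarrow> S \<subseteq> U \<Longrightarrow> vgen sc Y vac S \<subseteq> U"
  unfolding vgen_alt by blast

lemma vgen_superset: "S \<subseteq> vgen sc Y vac S"
  unfolding vgen_alt by blast

lemma vgen_mono: "S \<subseteq> T \<Longrightarrow> vgen sc Y vac S \<subseteq> vgen sc Y vac T"
  unfolding vgen_alt by blast

lemma subalgebraD:
  assumes "subalgebra U"
  shows "vac \<in> U" "0 \<in> U" "u \<in> U \<Longrightarrow> v \<in> U \<Longrightarrow> u + v \<in> U" "u \<in> U \<Longrightarrow> v \<in> U \<Longrightarrow> u - v \<in> U"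
    "u \<in> U \<Longrightarrow> sc c u \<in> U" "u \<in> U \<Longrightarrow> v \<in> U \<Longrightarrow> Y n u v \<in> U"
    "(\<And>i. i \<in> I \<Longrightarrow> g i \<in> U) \<Longrightarrow> sum g I \<in> U"
  using assms by (auto simp: subalgebra_def subspace_0 subspace_add subspace_diff subspace_scale subspace_sum)

lemma subspace_scale_cancel: "subspace U \<Longrightarrow> c \<noteq> 0 \<Longrightarrow> sc c u \<in> U \<Longrightarrow> u \<in> U"
  using subspace_scale[of U "sc c u" "inverse c"] by simp

text \<open>The vectors all of whose modes preserve \<open>P\<close> form a subalgebra, and
  \<open>u = u(-1) vac\<close>.\<close>

lemma vgen_subset_invariant:
  assumes P: "subspace P" "vac \<in> P"
    and S: "\<And>s n v. s \<in> S \<Longrightarrow> v \<in> P \<Longrightarrow> Y n s v \<in> P"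
  shows "vgen sc Y vac S \<subseteq> P"
proof -
  define Q where "Q = {u. \<forall>n. \<forall>v\<in>P. Y n u v \<in> P}"
  have "Y n (Y l u v) w \<in> P" if "u \<in> Q" "v \<in> Q" "w \<in> P" for u v w n l
  proof -
    from iterate[of n l u v w] obtain N where "Y n (Y l u v) w =
      (\<Sum>i\<le>N. sc ((-1) ^ i * (of_int l gchoose i))
         (Y (l - int i) u (Y (n + int i) v w) - sc (sgn_pow l) (Y (l + n - int i) v (Y (int i) u w))))"
      by blast
    also have "\<dots> \<in> P"
      using that P(1) unfolding Q_def by (intro subspace_sum subspace_scale subspace_diff) auto
    finally show ?thesis .
  qed
  then have "subalgebra Q"
    using P by (auto simp: subalgebra_def Q_def Y_vac_left Y_linear subspace_0 subspace_add
        subspace_scale intro!: subspaceI)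
  then have "vgen sc Y vac S \<subseteq> Q"
    by (rule vgen_least) (use S in \<open>auto simp: Q_def\<close>)
  moreover have "u \<in> P" if "u \<in> Q" for u
  proof -
    have "Y (-1) u vac \<in> P" using that P(2) unfolding Q_def by blast
    then show ?thesis by (simp add: Y_creation)
  qed
  ultimately show ?thesis by blast
qed

text \<open>One side of the Borcherds identity contains only modes of products of \<open>u\<close>
  and \<open>v\<close>, so the other side lies in \<open>G\<close> even when \<open>u\<close> and
  \<open>v\<close> do not.\<close>

lemma subalgebra_borcherds:
  assumes G: "subalgebra G" and w: "w \<in> G" and uv: "\<And>i::nat. Y (l + int i) u v \<in> G"
  shows "\<exists>N0. \<forall>N\<ge>N0. (\<Sum>i\<le>N. sc ((-1) ^ i * (of_int l gchoose i))
         (Y (l + m - int i) u (Y (n + int i) v w)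
          - sc (sgn_pow l) (Y (l + n - int i) v (Y (m + int i) u w)))) \<in> G"
proof -
  have "(\<Sum>i\<le>N. sc (of_int m gchoose i) (Y (m + n - int i) (Y (l + int i) u v) w)) \<in> G" for N
    by (intro subalgebraD(7)[OF G] subalgebraD(5)[OF G] subalgebraD(6)[OF G uv w])
  moreover obtain N0 where "\<And>N. N \<ge> N0 \<Longrightarrow>
    (\<Sum>i\<le>N. sc ((-1) ^ i * (of_int l gchoose i))
         (Y (l + m - int i) u (Y (n + int i) v w)
          - sc (sgn_pow l) (Y (l + n - int i) v (Y (m + int i) u w)))) =
    (\<Sum>i\<le>N. sc (of_int m gchoose i) (Y (m + n - int i) (Y (l + int i) u v) w))"
    using borcherds[of m n l u v w] by force
  ultimately show ?thesis by (intro exI[of _ N0]) simp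
qed

text \<open>Choosing \<open>m\<close> so large that \<open>u(m + i) w = 0\<close>, the Borcherds identity expresses
  \<open>u(p) v(n) w\<close> through \<open>u(p - i) v(n + i) w\<close> with \<open>i > 0\<close>; these vanish for large \<open>n\<close>.\<close>

lemma subalgebra_product_modes:
  assumes G: "subalgebra G" and w: "w \<in> G" and uv: "\<And>i. Y i u v \<in> G"
  shows "Y p u (Y n v w) \<in> G"
proof -
  obtain M where M: "\<And>i. i \<ge> M \<Longrightarrow> Y i u w = 0" using Y_truncation[of u w] by blast
  obtain K where K: "\<And>i. i \<ge> K \<Longrightarrow> Y i v w = 0" using Y_truncation[of v w] by blast
  have "\<forall>p. Y p u (Y n v w) \<in> G" for n
  proof (induction "nat (K - n)" arbitrary: n rule: less_induct)
    case less
    show ?case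
    proof (cases "n \<ge> K")
      case True
      then show ?thesis using subalgebraD(2)[OF G] by (simp add: K Y_linear)
    next
      case False
      show ?thesis
      proof
        fix p
        define g where "g i = sc ((-1) ^ i * (of_int (p - M) gchoose i)) (Y (p - int i) u (Y (n + int i) v w))" for i
        obtain N where N: "(\<Sum>i\<le>N. g i) \<in> G"
          using subalgebra_borcherds[OF G w uv, of "p - M" M n] unfolding g_def
          by (auto simp: M Y_right simp del: of_int_diff)
        have "g i \<in> G" if "i \<noteq> 0" for i
          unfolding g_def using that False less[of "n + int i"] by (intro subalgebraD(5)[OF G]) auto
        then have "(\<Sum>i\<in>{..N} - {0}. g i) \<in> G"
          by (intro subalgebraD(7)[OF G]) auto
        moreover have "g 0 = (\<Sum>i\<le>N. g i) - (\<Sum>i\<in>{..N} - {0}. g i)"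
          by (simp add: sum.remove[of "{..N}" 0 g])
        ultimately have "g 0 \<in> G" using N subalgebraD(4)[OF G] by simp
        then show "Y p u (Y n v w) \<in> G" by (simp add: g_def)
      qed
    qed
  qed
  then show ?thesis by blast
qed

section \<open>Kernels of operators on spans of eigenvectors\<close>

text \<open>Applying \<open>T - ev j\<close> deletes the summand \<open>g j\<close> and rescales the
  others, which gives an induction on the number of summands.\<close>

lemma eigenvector_sum_eq_0:
  assumes T: "Vector_Spaces.linear sc sc T" and "finite I"
    and "\<And>i. i \<in> I \<Longrightarrow> T (g i) = sc (ev i) (g i)" "\<And>i. i \<in> I \<Longrightarrow> ev i \<noteq> \<mu>"
    and "T (\<Sum>i\<in>I. g i) = sc \<mu> (\<Sum>i\<in>I. g i)"
  shows "(\<Sum>i\<in>I. g i) = 0"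
  using assms(2-)
proof (induction I arbitrary: g rule: finite_induct)
  case (insert j I)
  define s where "s = (\<Sum>i\<in>insert j I. g i)"
  have *: "(\<Sum>i\<in>I. sc (ev i - ev j) (g i)) = sc (\<mu> - ev j) s"
  proof -
    have "sc (\<mu> - ev j) s = T s - sc (ev j) s"
      using insert.prems(3) by (simp add: s_def scale_left_diff_distrib)
    also have "\<dots> = (\<Sum>i\<in>insert j I. sc (ev i - ev j) (g i))"
      by (simp add: s_def linear_facts(6)[OF T] insert.prems(1) scale_sum_right sum_subtractf
          scale_left_diff_distrib del: sum.insert insert_iff cong: sum.cong_simp)
    finally show ?thesis using insert.hyps by simp
  qed
  have "(\<Sum>i\<in>I. sc (ev i - ev j) (g i)) = 0"
  proof (rule insert.IH)
    show "T (\<Sum>i\<in>I. sc (ev i - ev j) (g i)) = sc \<mu> (\<Sum>i\<in>I. sc (ev i - ev j) (g i))"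
      using insert.prems(3) unfolding * s_def[symmetric] by (simp add: linear_facts(5)[OF T] mult.commute)
  qed (use insert.prems in \<open>auto simp: linear_facts(5)[OF T] mult.commute\<close>)
  then have "sc (\<mu> - ev j) s = 0" using * by simp
  then show ?case using insert.prems(2)[of j] unfolding s_def[symmetric] by simp
qed simp

text \<open>\<open>T\<close> kills the terms of \<open>v\<close> that lie in \<open>U\<close>, hence
  also the sum of the others; these have nonzero eigenvalues, so their sum is 0. This serves both
  for PBW monomials under \<open>h(0)\<close> and for \<open>heis\<close> under
  \<open>b(1)\<close>.\<close>

lemma kernel_span_subset:
  assumes T: "Vector_Spaces.linear sc sc T" and U: "subspace U" "\<And>u. u \<in> U \<Longrightarrow> T u = 0"
    and S: "\<And>s. s \<in> S \<Longrightarrow> s \<in> U \<or> (\<exists>c. c \<noteq> 0 \<and> T s = sc c s)"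
    and v: "v \<in> span S" "T v = 0"
  shows "v \<in> U"
proof -
  from v(1) obtain t r where t: "finite t" "t \<subseteq> S" and v_eq: "v = (\<Sum>a\<in>t. sc (r a) a)"
    unfolding span_explicit by blast
  from S obtain ev where ev: "\<And>s. s \<in> S \<Longrightarrow> s \<notin> U \<Longrightarrow> ev s \<noteq> 0 \<and> T s = sc (ev s) s" by metis
  define u where "u = (\<Sum>a\<in>t \<inter> U. sc (r a) a)"
  have u: "u \<in> U" unfolding u_def using U(1) by (intro subspace_sum subspace_scale) auto
  have eq: "v = u + (\<Sum>a\<in>t - U. sc (r a) a)"
    unfolding v_eq u_def using sum.Int_Diff[OF t(1)] by blast
  have "(\<Sum>a\<in>t - U. sc (r a) a) = 0"
  proof (rule eigenvector_sum_eq_0[OF T, where ev = ev and \<mu> = 0])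
    have "T (\<Sum>a\<in>t - U. sc (r a) a) = T v - T u" by (simp add: eq linear_facts[OF T])
    then show "T (\<Sum>a\<in>t - U. sc (r a) a) = sc 0 (\<Sum>a\<in>t - U. sc (r a) a)"
      using v(2) u U(2) by simp
  qed (use t ev in \<open>auto simp: linear_facts[OF T] mult.commute subset_iff\<close>)
  then show ?thesis using eq u by simp
qed

end

section \<open>The modes of affine sl2\<close>

text \<open>\<open>\<omega>\<close> and \<open>W\<close> have weights 2 and 3, so
  \<open>h(m)\<close> kills them for degree reasons once \<open>m \<ge> 4\<close>; smaller
  \<open>m\<close> are computed one by one.\<close>

lemma nonneg_cases_4:
  assumes "(m::int) \<ge> 0"
  obtains "m = 0" | "m = 1" | "m = 2" | "m = 3" | "m \<ge> 4"
  using assms by linarith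

locale affine_vertex_alg =
  fixes sc :: "complex \<Rightarrow> 'v::ab_group_add \<Rightarrow> 'v"
    and Y :: "int \<Rightarrow> 'v \<Rightarrow> 'v \<Rightarrow> 'v" and vac :: 'v and x :: "nat \<Rightarrow> 'v" and k :: int
  assumes k_pos: "k > 0" and Vk0: "is_Vk0 sc Y vac x k"
begin

sublocale vertex_alg sc Y vac
  using Vk0 by unfold_locales (simp add: is_Vk0_def)

text \<open>Opaque names, since the simplifier would rewrite \<open>x 1\<close> to \<open>x (Suc 0)\<close>.\<close>

definition h where "h = x 0"
definition e where "e = x 1"
definition f where "f = x 2"

lemma affine_relation:
  assumes "a < 3" "b < 3"
  shows "Y m (x a) (Y n (x b) v) = Y n (x b) (Y m (x a) v) +
      ((\<Sum>c<3. sc (sl2_br a b c) (Y (m + n) (x c) v)) +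
        (if m + n = 0 then sc (of_int m * sl2_form a b * of_int k) v else 0))"
proof -
  have "Y m (x a) (Y n (x b) v) - Y n (x b) (Y m (x a) v) =
      (\<Sum>c<3. sc (sl2_br a b c) (Y (m + n) (x c) v)) +
        (if m + n = 0 then sc (of_int m * sl2_form a b * of_int k) v else 0)"
    using Vk0 assms unfolding is_Vk0_def by blast
  then show ?thesis by (metis add.commute diff_add_cancel)
qed

lemma sum_lessThan_3: "(\<Sum>c<(3::nat). g c) = g 0 + g 1 + (g 2 :: 'v)"
  by (simp add: eval_nat_numeral)

lemma hh: "Y m h (Y n h v) = Y n h (Y m h v) + (if m + n = 0 then sc (2 * of_int m * of_int k) v else 0)"
  and he: "Y m h (Y n e v) = Y n e (Y m h v) + sc 2 (Y (m + n) e v)"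
  and hf: "Y m h (Y n f v) = Y n f (Y m h v) - sc 2 (Y (m + n) f v)"
  and ef: "Y m e (Y n f v) = Y n f (Y m e v) + Y (m + n) h v + (if m + n = 0 then sc (of_int m * of_int k) v else 0)"
  and fe: "Y m f (Y n e v) = Y n e (Y m f v) - Y (m + n) h v + (if m + n = 0 then sc (of_int m * of_int k) v else 0)"
  and ee: "Y m e (Y n e v) = Y n e (Y m e v)"
  and ff: "Y m f (Y n f v) = Y n f (Y m f v)"
  using affine_relation[of 0 0 m n v] affine_relation[of 0 1 m n v] affine_relation[of 0 2 m n v]
    affine_relation[of 1 2 m n v] affine_relation[of 2 1 m n v] affine_relation[of 1 1 m n v]
    affine_relation[of 2 2 m n v]
  by (simp_all add: sum_lessThan_3 sl2_br_def sl2_form_def h_def e_def f_def mult.commute)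

lemma Y_hh: "i \<ge> 0 \<Longrightarrow> Y i h h = (if i = 1 then sc (2 * of_int k) vac else 0)"
  using hh[of i "-1" vac] by (simp add: Y_creation Y_vac_right Y_linear)

lemma Y_hf: "i \<ge> 0 \<Longrightarrow> Y i h f = (if i = 0 then sc (-2) f else 0)"
  using hf[of i "-1" vac] by (auto simp add: Y_creation Y_vac_right Y_linear)

lemma Y_ef: "i \<ge> 0 \<Longrightarrow> Y i e f = (if i = 0 then h else if i = 1 then sc (of_int k) vac else 0)"
  using ef[of i "-1" vac] by (auto simp add: Y_creation Y_vac_right Y_linear)

lemma Y_ff: "i \<ge> 0 \<Longrightarrow> Y i f f = 0"
  using ff[of i "-1" vac] by (auto simp add: Y_creation Y_vac_right Y_linear)

section \<open>The two generators and the commutant \<open>N0\<close>\<close>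

abbreviation "\<omega> \<equiv> omega sc Y vac x k"
abbreviation "W \<equiv> W3 sc Y vac x k"

lemma omega_eq: "\<omega> = sc (1 / (2 * of_int k * (of_int k + 2)))
    (sc (- of_int k) (Y (-2) h vac) - Y (-1) h (Y (-1) h vac) + sc (2 * of_int k) (Y (-1) e (Y (-1) f vac)))"
  by (simp only: omega_def h_def e_def f_def)

lemma W3_eq: "W = sc (of_int k ^ 2) (Y (-3) h vac) + sc (3 * of_int k) (Y (-2) h (Y (-1) h vac))
     + sc 2 (Y (-1) h (Y (-1) h (Y (-1) h vac))) - sc (6 * of_int k) (Y (-1) h (Y (-1) e (Y (-1) f vac)))
     + sc (3 * of_int k ^ 2) (Y (-2) e (Y (-1) f vac)) - sc (3 * of_int k ^ 2) (Y (-1) e (Y (-2) f vac))"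
  by (simp only: W3_def h_def e_def f_def)

text \<open>The sign conditions turn the relations into terminating rewrite rules that push
  annihilating modes towards \<open>vac\<close>.\<close>

lemma annihilation_to_right:
  assumes "m \<ge> 0" "n < 0"
  shows "Y m h (Y n h v) = Y n h (Y m h v) + (if m + n = 0 then sc (2 * of_int m * of_int k) v else 0)"
    "Y m h (Y n e v) = Y n e (Y m h v) + sc 2 (Y (m + n) e v)"
    "Y m h (Y n f v) = Y n f (Y m h v) - sc 2 (Y (m + n) f v)"
    "Y m e (Y n f v) = Y n f (Y m e v) + Y (m + n) h v + (if m + n = 0 then sc (of_int m * of_int k) v else 0)"
  by (rule hh he hf ef)+

text \<open>With numerals expanded and powers of \<open>k\<close> kept as nested scalars, the terms
  of \<open>h(m) \<omega>\<close> and \<open>h(m) W\<close> cancel by abelian group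
  arithmetic.\<close>

lemma scale_numerals:
  "sc 2 v = v + v" "sc 3 v = v + v + v" "sc 4 v = sc 2 (sc 2 v)" "sc 6 v = sc 3 (sc 2 v)"
  "sc 12 v = sc 3 (sc 4 v)"
proof -
  show "sc 2 v = v + v" using scale_left_distrib[of 1 1 v] by simp
  then show "sc 3 v = v + v + v" using scale_left_distrib[of 1 2 v] by (simp add: add.assoc)
qed simp_all

lemma omega_in_N0: "\<omega> \<in> N0 Y x"
proof -
  have "Y m h (sc (- of_int k) (Y (-2) h vac) - Y (-1) h (Y (-1) h vac)
      + sc (2 * of_int k) (Y (-1) e (Y (-1) f vac))) = 0" if "m \<ge> 0" for m
    using that by (cases rule: nonneg_cases_4)
      (auto simp add: Y_right annihilation_to_right Y_vac_right scale_right_distrib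
        scale_right_diff_distrib scale_numerals simp del: scale_scale simp flip: scale_scale)
  then have "Y m h \<omega> = 0" if "m \<ge> 0" for m
    using that by (simp only: omega_eq Y_right(5) scale_zero_right)
  then show ?thesis by (simp add: N0_def h_def)
qed

lemma W3_in_N0: "W \<in> N0 Y x"
proof -
  have "Y m h W = 0" if "m \<ge> 0" for m
    using that by (cases rule: nonneg_cases_4)
      (auto simp add: W3_eq Y_right annihilation_to_right Y_vac_right scale_right_distrib
        scale_right_diff_distrib power2_eq_square scale_numerals simp del: scale_scale simp flip: scale_scale)
  then show ?thesis by (simp add: N0_def h_def)
qed

text \<open>Modes of \<open>u \<in> N0\<close> commute with every \<open>h(m)\<close>, so
  \<open>h(m)\<close> passes through \<open>u(n)\<close> and kills \<open>v\<close>.\<close>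

lemma N0_subalgebra: "subalgebra (N0 Y x)"
proof -
  have "Y m h (Y n u v) = 0" if "u \<in> N0 Y x" "v \<in> N0 Y x" "m \<ge> 0" for m n u v
    using that Y_commute[of h u m n v] by (simp add: N0_def h_def Y_linear)
  then show ?thesis
    by (auto simp: subalgebra_def N0_def h_def[symmetric] Y_linear Y_vac_right intro!: subspaceI)
qed

section \<open>The kernel of h(0)\<close>

definition G where "G = vgen sc Y vac {h, \<omega>, W}"

lemma G_subalgebra: "subalgebra G"
  unfolding G_def by (rule subalgebra_vgen)

lemmas G_closed = subalgebraD[OF G_subalgebra]

lemma generators_in_G: "h \<in> G" "\<omega> \<in> G" "W \<in> G"
  unfolding G_def using vgen_superset[of "{h, \<omega>, W}"] by simp_all

lemma G_subspace: "subspace G"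
  using G_subalgebra by (simp add: subalgebra_def)

section \<open>The products of \<open>e\<close> and \<open>f\<close> in \<open>G\<close>\<close>

lemma e1f1_in_G: "Y (-1) e f \<in> G"
proof -
  let ?A = "sc (- of_int k) (Y (-2) h vac) - Y (-1) h (Y (-1) h vac) + sc (2 * of_int k) (Y (-1) e f)"
  have "of_int k + (2::complex) = of_int (k + 2)" by simp
  then have nz: "1 / (2 * of_int k * (of_int k + 2)) \<noteq> (0::complex)"
    using k_pos by (simp del: of_int_add)
  have "\<omega> = sc (1 / (2 * of_int k * (of_int k + 2))) ?A"
    by (simp only: omega_eq Y_creation)
  then have A: "?A \<in> G" using generators_in_G(2) nz subspace_scale_cancel[OF G_subspace] by metis
  have B: "sc (- of_int k) (Y (-2) h vac) - Y (-1) h (Y (-1) h vac) \<in> G"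
    by (intro G_closed generators_in_G)
  have "sc (2 * of_int k) (Y (-1) e f) = ?A - (sc (- of_int k) (Y (-2) h vac) - Y (-1) h (Y (-1) h vac))"
    by simp
  also have "\<dots> \<in> G" by (rule G_closed(4)[OF A B])
  finally show ?thesis
    by (rule subspace_scale_cancel[OF G_subspace, rotated]) (use k_pos in simp)
qed

text \<open>This is the translate of \<open>e(l)f\<close>, and \<open>G\<close> is closed under
  translation.\<close>

lemma e_f2_in_G:
  assumes "Y l e f \<in> G"
  shows "Y l e (Y (-2) f vac) - sc (of_int l) (Y (l - 1) e f) \<in> G"
  unfolding translation_product[symmetric] by (intro G_closed assms)

text \<open>Modulo \<open>G\<close>, \<open>W\<close> gives the difference of \<open>e(-2)f\<close>
  and \<open>e(-1)f(-2) vac\<close>, while the translate of \<open>e(-1)f\<close> gives their sum;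
  together they isolate \<open>e(-2)f\<close> with coefficient \<open>6k^2\<close>.\<close>

lemma e2f1_in_G: "Y (-2) e f \<in> G"
proof -
  let ?B = "sc (of_int k ^ 2) (Y (-3) h vac) + sc (3 * of_int k) (Y (-2) h (Y (-1) h vac))
     + sc 2 (Y (-1) h (Y (-1) h (Y (-1) h vac))) - sc (6 * of_int k) (Y (-1) h (Y (-1) e f))"
  let ?c = "3 * of_int k ^ 2 :: complex"
  let ?D = "Y (-1) e (Y (-2) f vac) + Y (-2) e f"
  have D: "?D \<in> G"
    using e_f2_in_G[OF e1f1_in_G] by simp
  have "?B \<in> G"
    by (intro G_closed(3-5) G_closed(6)[OF generators_in_G(1)] G_closed(1) e1f1_in_G)
  then have B: "?B - sc ?c ?D \<in> G" by (rule G_closed(4)) (rule G_closed(5)[OF D])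
  have "W = ?B + sc ?c (Y (-2) e f) - sc ?c (Y (-1) e (Y (-2) f vac))"
    by (simp only: W3_eq Y_creation)
  also have "\<dots> = (?B - sc ?c ?D) + sc (?c + ?c) (Y (-2) e f)"
    by (simp only: scale_right_distrib scale_left_distrib) simp
  finally have "sc (?c + ?c) (Y (-2) e f) = W - (?B - sc ?c ?D)"
    by (simp only: add_diff_cancel_left')
  also have "\<dots> \<in> G" by (rule G_closed(4)[OF generators_in_G(3) B])
  finally show ?thesis
    by (rule subspace_scale_cancel[OF G_subspace, rotated]) (use k_pos in simp)
qed

text \<open>The Borcherds identity for \<open>u = e\<close>, \<open>v = f\<close>, \<open>l = -2\<close>, \<open>m = 1\<close>, \<open>n = 0\<close>, applied to
  \<open>e(-m)f\<close>: modulo \<open>G\<close> its right-hand side is a positive multiple, namely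
  \<open>m\<^sup>2(k + 1) + m(2k + 3) + 2\<close>, of \<open>e(-m-1)f\<close>.\<close>

lemma e_f1_step:
  assumes "m > 0" and IH: "\<And>i. i \<le> m \<Longrightarrow> Y (- int i) e f \<in> G"
  shows "Y (- int (Suc m)) e f \<in> G"
proof -
  define u where "u = Y (- int (Suc m)) e f"
  have u: "Y (-1 - int m) e f = u" "Y (- int m - 1) e f = u"
    unfolding u_def by (rule arg_cong[where f = "\<lambda>l. Y l e f"]; simp)+
  define w where "w = Y (- int m) e f"
  have w: "w \<in> G" unfolding w_def by (rule IH) simp
  define t where "t i = sc ((-1) ^ i * (of_int (-2) gchoose i))
     (Y (-1 - int i) e (Y (int i) f w) - Y (-2 - int i) f (Y (1 + int i) e w))" for i
  \<comment> \<open>With \<open>l = -2\<close>, only the two products already found and the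
    nonnegative ones occur on the other side of the identity.\<close>
  have "Y (-2 + int i) e f \<in> G" for i
  proof -
    consider "i = 0" | "i = 1" | "-2 + int i \<ge> 0" by linarith
    then show ?thesis
      by cases (use e1f1_in_G e2f1_in_G generators_in_G G_closed(1,2,5) in \<open>auto simp: Y_ef\<close>)
  qed
  from subalgebra_borcherds[OF G_subalgebra w this, of 1 0]
  obtain N0 where N0: "\<And>N. N \<ge> N0 \<Longrightarrow> (\<Sum>i\<le>N. t i) \<in> G"
    unfolding t_def by (auto simp: sgn_pow_def)
  have coeff: "(-1) ^ i * (of_int (-2) gchoose i) = (of_nat (Suc i) :: complex)" for i
  proof -
    have "(1 + of_nat i gchoose i) = (1 + of_nat i :: complex)"
      using binomial_gbinomial[of "Suc i" i, where 'a = complex] by simp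
    then show ?thesis using gbinomial_negated_upper[of "-2::complex" i]
      by (simp add: power_mult_distrib[symmetric] mult.assoc[symmetric])
  qed
  have e_w: "Y (1 + int i) e w = (if i = 0 then sc (of_int k) (Y (- int m) e vac) else 0)" for i
    unfolding w_def using ee[of "1 + int i" "- int m" f] by (simp add: Y_ef Y_linear)
  have f_w: "Y (int i) f w = (if i = m then sc (of_nat m * of_int k) f else 0) - Y (int i - int m) h f" for i
    unfolding w_def using fe[of "int i" "- int m" f] by (simp add: Y_ff Y_linear)
  \<comment> \<open>\<open>c i\<close> is the coefficient of \<open>u\<close> in \<open>t i\<close>
    modulo \<open>G\<close>. The 2 comes from moving \<open>h(i - m)\<close> past
    \<open>e(-1 - i)\<close>, or from \<open>h(0)f = -2f\<close> when \<open>i = m\<close>;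
    \<open>m k\<close> is the central term of \<open>f(m)\<close> and \<open>e(-m)\<close>; the last
    summand comes from \<open>e(1)f = k vac\<close>.\<close>
  define c :: "nat \<Rightarrow> int" where "c i = int (Suc i) * (if i < m then 2 else if i = m then int m * k + 2 else 0)
     + (if i = 0 then k * int m else 0)" for i
  have first: "sc (of_nat (Suc i)) (Y (-1 - int i) e (Y (int i) f w))
      - sc (of_int (int (Suc i) * (if i < m then 2 else if i = m then int m * k + 2 else 0))) u \<in> G" for i
  proof -
    consider "i < m" | "i = m" | "i > m" by linarith
    then show ?thesis
    proof cases
      case 1
      have "Y (-1 - int i) e (Y (int i - int m) h f) =
          Y (int i - int m) h (Y (- int (Suc i)) e f) - sc 2 u"
        using he[of "int i - int m" "-1 - int i" f] by (simp add: u)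
      moreover have "- sc (of_nat (Suc i)) (Y (int i - int m) h (Y (- int (Suc i)) e f)) \<in> G"
        by (rule subspace_neg[OF G_subspace], rule G_closed(5), rule G_closed(6)[OF generators_in_G(1)], rule IH)
          (use 1 in simp)
      ultimately show ?thesis
        using 1 by (simp add: f_w Y_linear scale_right_diff_distrib)
    next
      case 2
      then show ?thesis using G_closed(2)
        by (simp add: f_w Y_linear u Y_hf flip: scale_left_distrib)
    next
      case 3
      then show ?thesis using G_closed(2) by (simp add: f_w Y_linear Y_hf)
    qed
  qed
  have second: "- sc (of_nat (Suc i)) (Y (-2 - int i) f (Y (1 + int i) e w))
      - sc (of_int (if i = 0 then k * int m else 0)) u \<in> G" for i
  proof (cases "i = 0")
    case True
    \<comment> \<open>Translation replaces \<open>e(-m)f(-2) vac\<close> by \<open>-m u\<close>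
      modulo \<open>G\<close>.\<close>
    define b where "b = Y (- int m) e (Y (-2) f vac) - sc (of_int (- int m)) u"
    have b: "b \<in> G" using e_f2_in_G[OF w[unfolded w_def]] by (simp add: b_def u)
    have eq: "Y (-2) f (Y (- int m) e vac) = b - sc (of_nat m) u - Y (-2 - int m) h vac"
      using fe[of "-2" "- int m" vac] assms(1) by (simp add: b_def)
    have "sc (of_int k) (Y (-2 - int m) h vac - b) \<in> G"
      by (rule G_closed(5), rule G_closed(4)[OF G_closed(6)[OF generators_in_G(1) G_closed(1)] b])
    then show ?thesis using True e_w[of 0]
      by (simp add: Y_linear eq scale_right_diff_distrib)
  qed (simp add: e_w Y_linear G_closed)
  have t: "t i - sc (of_int (c i)) u \<in> G" for i
  proof -
    have "t i - sc (of_int (c i)) u = (sc (of_nat (Suc i)) (Y (-1 - int i) e (Y (int i) f w))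
      - sc (of_int (int (Suc i) * (if i < m then 2 else if i = m then int m * k + 2 else 0))) u)
      + (- sc (of_nat (Suc i)) (Y (-2 - int i) f (Y (1 + int i) e w))
      - sc (of_int (if i = 0 then k * int m else 0)) u)"
      unfolding t_def c_def coeff of_int_add scale_left_distrib scale_right_diff_distrib by simp
    also have "\<dots> \<in> G" by (rule G_closed(3)[OF first second])
    finally show ?thesis .
  qed
  have "(\<Sum>i\<le>N0. t i) - (\<Sum>i\<le>N0. t i - sc (of_int (c i)) u) \<in> G"
    by (rule G_closed(4)[OF N0 G_closed(7)[OF t]]) simp
  then have "sc (of_int (\<Sum>i\<le>N0. c i)) u \<in> G"
    by (simp add: sum_subtractf scale_sum_left)
  \<comment> \<open>The cutoff \<open>N0\<close> is unspecified, so positivity is derived termwise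
    instead of evaluating the sum.\<close>
  moreover have "(\<Sum>i\<le>N0. c i) > 0"
  proof -
    have km: "k * int m > 0" using k_pos assms(1) by simp
    have "c i \<ge> 0" for i
      unfolding c_def by (intro add_nonneg_nonneg mult_nonneg_nonneg) (use km in \<open>auto simp: mult.commute\<close>)
    moreover have "c 0 > 0" unfolding c_def using km assms(1) by simp
    ultimately show ?thesis by (intro sum_pos2[of _ 0]) auto
  qed
  ultimately show ?thesis
    using subspace_scale_cancel[OF G_subspace] unfolding u_def by (metis of_int_eq_0_iff less_irrefl)
qed

lemma e_f1_in_G: "Y i e f \<in> G"
proof (cases "i \<ge> 0")
  case True
  then show ?thesis using generators_in_G(1) G_closed(1,2,5) by (auto simp: Y_ef)
next
  case False
  have "Y (- int m) e f \<in> G" for m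
  proof (induction m rule: less_induct)
    case (less m)
    consider "m = 0" | "m = 1" | n where "m = Suc n" "n > 0" by (cases m) auto
    then show ?case
    proof cases
      case 1 then show ?thesis using generators_in_G(1) by (simp add: Y_ef)
    next
      case 2 then show ?thesis using e1f1_in_G by simp
    next
      case 3 then show ?thesis using e_f1_step[of n] less by simp
    qed
  qed
  from this[of "nat (- i)"] False show ?thesis by simp
qed

section \<open>PBW monomials of charge zero\<close>

lemma ef_mode_in_G: "w \<in> G \<Longrightarrow> Y p e (Y n f w) \<in> G"
  by (rule subalgebra_product_modes[OF G_subalgebra _ e_f1_in_G])

lemma fe_mode_in_G: "w \<in> G \<Longrightarrow> Y p f (Y n e w) \<in> G"
  unfolding fe[of p n] using ef_mode_in_G generators_in_G G_closed by simp

text \<open>For \<open>n \<ge> 0\<close>, \<open>tower f n\<close> and \<open>tower e n\<close> capture the vectors of charge \<open>n\<close> and \<open>-n\<close>,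
  respectively, that return to \<open>G\<close> under any \<open>n\<close> modes of \<open>f\<close>, respectively \<open>e\<close>.\<close>

primrec tower :: "'v \<Rightarrow> nat \<Rightarrow> 'v set" where
  "tower a 0 = G"
| "tower a (Suc n) = {v. \<forall>m. Y m a v \<in> tower a n}"

lemma tower_subspace: "subspace (tower a n)"
proof (induction n)
  case 0 then show ?case by (simp add: G_subspace)
next
  case (Suc n)
  then show ?case
    by (auto intro!: subspaceI simp: Y_right subspace_0 subspace_add subspace_scale)
qed

text \<open>Commuting \<open>a(p)\<close> past \<open>h(m)\<close> costs only a multiple of
  \<open>a(m + p)\<close>, which also leads one level down.\<close>

lemma tower_h:
  assumes "a = e \<or> a = f" "v \<in> tower a n"
  shows "Y m h v \<in> tower a n"
  using assms(2)
proof (induction n arbitrary: v m)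
  case 0 then show ?case using generators_in_G(1) G_closed(6) by simp
next
  case (Suc n)
  have "Y p a (Y m h v) \<in> tower a n" for p
  proof -
    have "Y p a (Y m h v) \<in> {Y m h (Y p a v) - sc 2 (Y (m + p) a v), Y m h (Y p a v) + sc 2 (Y (m + p) a v)}"
      using assms(1) he[of m p v] hf[of m p v] by auto
    moreover have "Y m h (Y p a v) \<in> tower a n" "Y (m + p) a v \<in> tower a n"
      using Suc by auto
    ultimately show ?thesis
      using tower_subspace[of a n] by (auto simp: subspace_add subspace_diff subspace_scale)
  qed
  then show ?case by simp
qed

text \<open>At level 0 this is stability of \<open>G\<close> under pairs of modes of
  \<open>e\<close> and \<open>f\<close>. Above it, moving \<open>a(p)\<close> past
  \<open>b(m)\<close> leaves an \<open>h\<close>-mode and a scalar, both of which preserve the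
  level.\<close>

lemma tower_raise:
  assumes "(a, b) = (e, f) \<or> (a, b) = (f, e)" "v \<in> tower a n"
  shows "Y m b v \<in> tower a (Suc n)"
  using assms(2)
proof (induction n arbitrary: v m)
  case 0
  from assms(1) show ?case
    by (rule disjE) (use 0 in \<open>simp_all add: ef_mode_in_G fe_mode_in_G\<close>)
next
  case (Suc n)
  have "Y p a (Y m b v) \<in> tower a (Suc n)" for p
  proof -
    obtain c where "Y p a (Y m b v) \<in> {Y m b (Y p a v) - Y (p + m) h v + sc c v, Y m b (Y p a v) + Y (p + m) h v + sc c v}"
      by (rule that[of "if p + m = 0 then of_int p * of_int k else 0"])
        (use assms(1) ef[of p m v] fe[of p m v] in auto)
    moreover have "Y m b (Y p a v) \<in> tower a (Suc n)" by (rule Suc.IH) (use Suc.prems in simp)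
    moreover have "Y (p + m) h v \<in> tower a (Suc n)" using tower_h[OF _ Suc.prems] assms(1) by auto
    ultimately show ?thesis
      using tower_subspace[of a "Suc n"] Suc.prems
      by (auto simp: subspace_add subspace_diff subspace_scale simp del: tower.simps)
  qed
  then show ?case by simp
qed

text \<open>Half the \<open>h(0)\<close>-eigenvalue of the monomial.\<close>

definition charge :: "(nat \<times> int) list \<Rightarrow> int" where
  "charge ms = (\<Sum>p\<leftarrow>ms. if fst p = 1 then 1 else if fst p = 2 then -1 else 0)"

lemma mono_Cons: "mono Y vac x (p # ms) = Y (snd p) (x (fst p)) (mono Y vac x ms)"
  by (simp add: mono_def)

lemma x_cases:
  assumes "a < 3"
  obtains "a = 0" "x a = h" | "a = 1" "x a = e" | "a = 2" "x a = f"
proof -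
  have "a = 0 \<or> a = 1 \<or> a = 2" using assms by linarith
  then show ?thesis using that by (auto simp: h_def e_def f_def)
qed

text \<open>Reading the word from the right, a mode that increases the absolute charge climbs by
  \<open>tower_raise\<close>, and one that decreases it descends by definition of
  \<open>tower\<close>. Charge zero means membership in \<open>G\<close>.\<close>

lemma mono_in_tower:
  assumes "\<forall>p\<in>set ms. fst p < 3"
  shows "mono Y vac x ms \<in> (if charge ms \<ge> 0 then tower f (nat (charge ms)) else tower e (nat (- charge ms)))"
  using assms
proof (induction ms)
  case Nil then show ?case by (simp add: mono_def charge_def G_closed(1))
next
  case (Cons p ms)
  define v where "v = mono Y vac x ms"
  define c where "c = charge ms"
  have IH: "c \<ge> 0 \<Longrightarrow> v \<in> tower f (nat c)" "c \<le> 0 \<Longrightarrow> v \<in> tower e (nat (- c))"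
    using Cons by (auto simp: v_def c_def split: if_splits)
  have "fst p < 3" using Cons.prems by simp
  then show ?case
  proof (cases rule: x_cases)
    case 1
    then show ?thesis using IH tower_h by (auto simp: mono_Cons charge_def v_def c_def)
  next
    case 2
    show ?thesis
    proof (cases "c \<ge> 0")
      case True
      have "Y (snd p) e v \<in> tower f (Suc (nat c))" using IH True by (intro tower_raise) auto
      then show ?thesis using 2 True by (simp add: mono_Cons charge_def v_def c_def nat_add_distrib del: tower.simps)
    next
      case False
      then have eq: "nat (- c) = Suc (nat (- 1 - c))" by simp
      have "Y (snd p) e v \<in> tower e (nat (- 1 - c))" using IH(2) False unfolding eq by simp
      \<comment> \<open>At \<open>c = -1\<close> the new charge is 0 and the claim switches to
        \<open>tower f\<close>; both towers start at \<open>G\<close>.\<close>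
      then show ?thesis using 2 False
        by (cases "c = -1") (auto simp: mono_Cons charge_def v_def c_def)
    qed
  next
    case 3
    show ?thesis
    proof (cases "c \<le> 0")
      case True
      have "Y (snd p) f v \<in> tower e (Suc (nat (- c)))" using IH True by (intro tower_raise) auto
      moreover have "Suc (nat (- c)) = nat (- (c - 1))" using True by simp
      ultimately show ?thesis using 3 True by (simp add: mono_Cons charge_def v_def c_def del: tower.simps)
    next
      case False
      then have eq: "nat c = Suc (nat (c - 1))" by simp
      have "Y (snd p) f v \<in> tower f (nat (c - 1))" using IH(1) False unfolding eq by simp
      then show ?thesis using 3 False by (auto simp: mono_Cons charge_def v_def c_def)
    qed
  qed
qed

lemma h0_mono:
  assumes "\<forall>p\<in>set ms. fst p < 3"
  shows "Y 0 h (mono Y vac x ms) = sc (2 * of_int (charge ms)) (mono Y vac x ms)"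
  using assms
proof (induction ms)
  case Nil then show ?case by (simp add: mono_def charge_def Y_vac_right)
next
  case (Cons p ms)
  have "fst p < 3" using Cons.prems by simp
  then show ?case
    by (cases rule: x_cases)
      (use Cons in \<open>simp_all add: mono_Cons charge_def hh[of 0] he hf Y_right algebra_simps\<close>)
qed

lemma ker_h0_subset_G:
  assumes "Y 0 h v = 0"
  shows "v \<in> G"
proof -
  \<comment> \<open>The intersection with the kernel provides a subspace on which
    \<open>h(0)\<close> vanishes, as \<open>kernel_span_subset\<close> requires.\<close>
  have "v \<in> G \<inter> {v. Y 0 h v = 0}"
  proof (rule kernel_span_subset[OF linear_Y_right, where S = "mono Y vac x ` pbw_words"])
    show "subspace (G \<inter> {v. Y 0 h v = 0})"
      by (intro subspace_inter G_subspace) (auto intro!: subspaceI simp: Y_right)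
    show "v \<in> span (mono Y vac x ` pbw_words)"
      using Vk0 by (simp add: is_Vk0_def)
  next
    fix s assume "s \<in> mono Y vac x ` pbw_words"
    then obtain ms where ms: "s = mono Y vac x ms" "\<forall>p\<in>set ms. fst p < 3"
      by (auto simp: pbw_words_def)
    show "s \<in> G \<inter> {v. Y 0 h v = 0} \<or> (\<exists>c. c \<noteq> 0 \<and> Y 0 h s = sc c s)"
    proof (cases "charge ms = 0")
      case True
      then show ?thesis using mono_in_tower[OF ms(2)] h0_mono[OF ms(2)] ms(1) by simp
    next
      case False
      then show ?thesis using h0_mono[OF ms(2)] ms(1)
        by (intro disjI2 exI[of _ "2 * of_int (charge ms)"]) simp
    qed
  qed (use assms in auto)
  then show ?thesis by simp
qed

section \<open>Splitting off the Heisenberg subalgebra\<close>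

definition U where "U = vgen sc Y vac {\<omega>, W}"

lemma U_subalgebra: "subalgebra U"
  unfolding U_def by (rule subalgebra_vgen)

lemma U_subset_N0: "U \<subseteq> N0 Y x"
  unfolding U_def by (rule vgen_least[OF N0_subalgebra]) (use omega_in_N0 W3_in_N0 in auto)

lemma U_annihilated: "u \<in> U \<Longrightarrow> m \<ge> 0 \<Longrightarrow> Y m h u = 0"
  using U_subset_N0 by (auto simp: N0_def h_def)

section \<open>Descendants of \<open>U\<close> under the Heisenberg modes\<close>

inductive_set heis :: "'v set" where
  base: "u \<in> U \<Longrightarrow> u \<in> heis"
| step: "v \<in> heis \<Longrightarrow> p < 0 \<Longrightarrow> Y p h v \<in> heis"

lemma Y_heis_span: "v \<in> span heis \<Longrightarrow> p < 0 \<Longrightarrow> Y p h v \<in> span heis"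
proof (induction rule: span_induct_alt)
  case base then show ?case by (simp add: Y_right span_zero)
next
  case (step c v w)
  then show ?case using heis.step[of v p] by (auto simp: Y_right intro!: span_add span_scale intro: span_base)
qed

text \<open>A nonnegative mode commutes up to scalars with the creating ones until it reaches and
  kills the vector of \<open>U\<close>.\<close>

lemma h_heis: "v \<in> heis \<Longrightarrow> Y n h v \<in> span heis"
proof (induction rule: heis.induct)
  case (base u)
  then show ?case
    by (cases "n < 0") (auto simp: U_annihilated span_zero not_less intro: span_base heis.intros)
next
  case (step v p)
  then show ?case
    unfolding hh[of n p] by (auto intro: span_add span_scale span_base Y_heis_span)
qed

text \<open>Modes of \<open>s\<close> commute with those of \<open>h\<close>, so they act on the
  innermost vector, which stays in \<open>U\<close>.\<close>

lemma U_heis: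
  assumes "s \<in> U"
  shows "v \<in> heis \<Longrightarrow> Y n s v \<in> span heis"
proof (induction rule: heis.induct)
  case (base u)
  then show ?case using subalgebraD(6)[OF U_subalgebra assms] by (intro span_base heis.base)
next
  case (step v p)
  have "Y n s (Y p h v) = Y p h (Y n s v)"
    using Y_commute[of h s p n v] U_annihilated[OF assms] by simp
  then show ?case using step by (simp add: Y_heis_span)
qed

lemma G_subset_heis: "G \<subseteq> span heis"
  unfolding G_def
proof (rule vgen_subset_invariant)
  show "vac \<in> span heis" using subalgebraD(1)[OF U_subalgebra] by (intro span_base heis.base)
  fix s n v assume s: "s \<in> {h, \<omega>, W}" and "v \<in> span heis"
  have "s = h \<or> s \<in> U" using s vgen_superset[of "{\<omega>, W}"] unfolding U_def by auto
  then have "Y n s v \<in> span heis" if "v \<in> heis" for v using that h_heis U_heis by blast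
  with \<open>v \<in> span heis\<close> show "Y n s v \<in> span heis"
    by (induction rule: span_induct_alt) (auto simp: Y_right span_zero intro: span_add span_scale)
qed simp

text \<open>Up to the factor \<open>1/(4k)\<close> this is the Virasoro vector of the Heisenberg subalgebra.\<close>

definition b where "b = Y (-1) h h"

lemma Y_hb: "i \<ge> 0 \<Longrightarrow> Y i h b = (if i = 1 then sc (4 * of_int k) h else 0)"
  using hh[of i "-1" h] unfolding b_def
  by (auto simp: Y_hh Y_linear Y_creation scale_left_distrib[symmetric])

text \<open>Only \<open>h(1)b = 4k h\<close> contributes to the commutator, so \<open>h(m)\<close>
  shifts \<open>b(1)\<close>-eigenvalues by \<open>-4km\<close>.\<close>

lemma b1_h: "Y 1 b (Y m h v) = Y m h (Y 1 b v) - sc (4 * of_int k * of_int m) (Y m h v)"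
proof -
  define g where "g i = sc (of_int m gchoose i) (Y (m + 1 - int i) (Y (int i) h b) v)" for i
  from commutator[of m h 1 b v] obtain N0 where
    N0: "\<And>N. N \<ge> N0 \<Longrightarrow> Y m h (Y 1 b v) - Y 1 b (Y m h v) = (\<Sum>i\<le>N. g i)"
    unfolding g_def by blast
  have "Y m h (Y 1 b v) - Y 1 b (Y m h v) = (\<Sum>i\<le>max N0 1. g i)" by (rule N0) simp
  also have "\<dots> = (\<Sum>i\<in>{1}. g i)"
    by (rule sum.mono_neutral_right) (auto simp: g_def Y_hb Y_linear)
  also have "\<dots> = sc (4 * of_int k * of_int m) (Y m h v)"
    by (simp add: g_def Y_hb Y_linear mult.commute)
  finally show ?thesis by (simp add: algebra_simps)
qed

text \<open>Every term of the iterate formula for \<open>h(-1)h\<close> applies a nonnegative mode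
  of \<open>h\<close> to \<open>v\<close> first.\<close>

lemma b1_N0:
  assumes "v \<in> N0 Y x"
  shows "Y 1 b v = 0"
proof -
  have *: "i \<ge> 0 \<Longrightarrow> Y i h v = 0" for i using assms by (simp add: N0_def h_def)
  obtain N where "Y 1 b v = (\<Sum>i\<le>N. sc ((-1) ^ i * (of_int (-1) gchoose i))
         (Y (-1 - int i) h (Y (1 + int i) h v) - sc (sgn_pow (-1)) (Y (-1 + 1 - int i) h (Y (int i) h v))))"
    using iterate[of 1 "-1" h h v] unfolding b_def by blast
  then show ?thesis by (simp add: * Y_right)
qed

lemma b1_heis:
  "v \<in> heis \<Longrightarrow> v \<in> U \<or> (\<exists>p. p < 0 \<and> Y 1 b v = sc (- 4 * of_int k * of_int p) v)"
proof (induction rule: heis.induct)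
  case (step v p)
  \<comment> \<open>\<open>q = 0\<close> covers \<open>v \<in> U\<close>; adding
    \<open>p < 0\<close> makes the total strictly negative.\<close>
  then obtain q where q: "q \<le> 0" "Y 1 b v = sc (- 4 * of_int k * of_int q) v"
    using b1_N0 U_subset_N0 by (metis less_imp_le mult_zero_right of_int_0 order_refl scale_zero_left subsetD)
  show ?case
    by (intro disjI2 exI[of _ "p + q"] conjI)
      (use q step in \<open>simp_all add: b1_h Y_right algebra_simps\<close>)
qed simp

lemma N0_eq_U: "N0 Y x = U"
proof
  show "N0 Y x \<subseteq> U"
  proof
    fix v assume v: "v \<in> N0 Y x"
    then have "Y 0 h v = 0" by (simp add: N0_def h_def)
    then have "v \<in> span heis" using ker_h0_subset_G G_subset_heis by blast
    moreover have "s \<in> U \<or> (\<exists>c. c \<noteq> 0 \<and> Y 1 b s = sc c s)" if "s \<in> heis" for s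
      using b1_heis[OF that] k_pos by (metis less_irrefl mult_eq_0_iff neg_equal_0_iff_equal of_int_eq_0_iff zero_neq_numeral)
    ultimately show "v \<in> U"
      using kernel_span_subset[OF linear_Y_right, of U 1 b heis v] U_subalgebra U_subset_N0 b1_N0 v
      unfolding subalgebra_def by blast
  qed
qed (rule U_subset_N0)

lemma N0_eq_vgen:
  assumes "S \<subseteq> N0 Y x"
  shows "N0 Y x = vgen sc Y vac ({\<omega>, W} \<union> S)"
proof
  show "vgen sc Y vac ({\<omega>, W} \<union> S) \<subseteq> N0 Y x"
    by (rule vgen_least[OF N0_subalgebra]) (use assms omega_in_N0 W3_in_N0 in auto)
  show "N0 Y x \<subseteq> vgen sc Y vac ({\<omega>, W} \<union> S)"
    unfolding N0_eq_U U_def by (rule vgen_mono) blast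
qed

end

theorem theorem3p1:
  fixes sc :: "complex \<Rightarrow> 'v::ab_group_add \<Rightarrow> 'v"
    and Y :: "int \<Rightarrow> 'v \<Rightarrow> 'v \<Rightarrow> 'v" and vac :: 'v and x :: "nat \<Rightarrow> 'v" and k :: int
  assumes "k \<ge> 2"
    and "is_Vk0 sc Y vac x k"
  shows "N0 Y x = vgen sc Y vac {omega sc Y vac x k, W3 sc Y vac x k}
         \<and> (\<forall>W4\<in>N0 Y x. \<forall>W5\<in>N0 Y x.
              N0 Y x = vgen sc Y vac {omega sc Y vac x k, W3 sc Y vac x k, W4, W5})"
proof -
  interpret affine_vertex_alg sc Y vac x k
    using assms by unfold_locales auto
  show ?thesis
    using N0_eq_vgen[of "{}"] N0_eq_vgen[of "{_, _}"] by (auto simp: insert_commute)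
qed

end
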